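(* In general there is no inclusion between $\mathcal{R}^{r}_{AS}$ and $\mathcal{R}^{r}_{ref}$: there exists $r\in\mathbb{N}=\{0,1,2,\ldots\}$ such that $\mathcal{R}^{r}_{AS}\not\subset\mathcal{R}^{r}_{ref}$ and $\mathcal{R}^{r}_{ref}\not\subset\mathcal{R}^{r}_{AS}$.
   Context: For $r\in\mathbb{N}$ (with $0\in\mathbb{N}$) and $z\in\mathbb{C}$ define $f_{r,z}\colon\mathbb{R}\to\mathbb{C}$ by $f_{r,z}(t)=\sum_{j=0}^{r+1}\frac{z^j}{j!}+\frac{t^{r+1}}{(r+1)!}z^{r+2}$. Let $\tau_1,\tau_2,\ldots$ be independent random variables, uniformly distributed on $[0,1]$, on a probability space $(\Omega,\Sigma,\mathbb{P})$, and fix $\eta\neq 0$. For $z\in\mathbb{C}$ put $v^r_k=v^r_k(z)=\eta\prod_{l=1}^k f_{r,z}(\tau_l)$, $k\in\mathbb{N}$. Define $\mathcal{R}^r_{AS}=\{z\in\mathbb{C}\colon v^r_k\to0 \text{ almost surely as } k\to\infty\}$ (region of asymptotic stability) and $\mathcal{R}^r_{ref}=\{z\in\mathbb{C}\colon |\sum_{j=0}^{r+2}\frac{z^j}{j!}|<1\}$ (reference set). *)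

theory Defs
  imports "HOL-Probability.Probability"
begin

definition f :: "nat \<Rightarrow> complex \<Rightarrow> real \<Rightarrow> complex" where
  "f r z t = (\<Sum>j=0..r+1. z ^ j / fact j) + complex_of_real (t ^ (r+1) / fact (r+1)) * z ^ (r+2)"

definition v :: "(nat \<Rightarrow> 'a \<Rightarrow> real) \<Rightarrow> complex \<Rightarrow> nat \<Rightarrow> complex \<Rightarrow> nat \<Rightarrow> 'a \<Rightarrow> complex" where
  "v \<tau> \<eta> r z k \<omega> = \<eta> * (\<Prod>l=1..k. f r z (\<tau> l \<omega>))"

definition R_AS :: "'a measure \<Rightarrow> (nat \<Rightarrow> 'a \<Rightarrow> real) \<Rightarrow> complex \<Rightarrow> nat \<Rightarrow> complex set" where
  "R_AS M \<tau> \<eta> r = {z. AE \<omega> in M. (\<lambda>k. v \<tau> \<eta> r z k \<omega>) \<longlonglongrightarrow> 0}"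

definition R_ref :: "nat \<Rightarrow> complex set" where
  "R_ref r = {z. cmod (\<Sum>j=0..r+2. z ^ j / fact j) < 1}"

end

theory Submission
  imports Defs
begin

text \<open>
  If \<open>h \<ge> 0\<close> and \<open>E h(\<tau>) < 1\<close>, then the expectations of the products \<open>h(\<tau>\<^sub>1) \<cdots> h(\<tau>\<^sub>k)\<close> form a
  convergent geometric series, so the products tend to \<open>0\<close> almost surely. Take \<open>r = 0\<close>. At \<open>z = -2\<close>
  the reference polynomial equals \<open>1\<close>, while \<open>f(t) = 4t - 1\<close> satisfies
  \<open>E \<bar>f(\<tau>)\<bar>\<^sup>1\<^sup>/\<^sup>4 = (1 + 3\<^sup>5\<^sup>/\<^sup>4)/5 < 1\<close>, so \<open>v\<^sub>k\<close> tends to \<open>0\<close>. At \<open>z = -1 + 12\<i>/7\<close>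
  the reference polynomial equals \<open>-95/98\<close>, while \<open>E \<bar>f(\<tau>)\<bar>\<^sup>-\<^sup>2 \<le> 14\<pi>/45 < 1\<close>, so \<open>v\<^sub>k\<close> tends to
  infinity.
\<close>

text \<open>Independence factors the expectation of each product. Working in \<open>ennreal\<close>
  allows sum and integral to be exchanged without integrability, and an integrable sum is finite
  almost surely.\<close>

lemma (in prob_space) AE_prod_tendsto_0:
  fixes X :: "nat \<Rightarrow> 'a \<Rightarrow> ennreal" and c :: real
  assumes indep: "indep_vars (\<lambda>_. borel) X {1..}"
    and le: "\<And>l. l \<ge> 1 \<Longrightarrow> (\<integral>\<^sup>+\<omega>. X l \<omega> \<partial>M) \<le> ennreal c"
    and c: "0 \<le> c" "c < 1"
  shows "AE \<omega> in M. (\<lambda>k. \<Prod>l=1..k. X l \<omega>) \<longlonglongrightarrow> 0"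
proof -
  have [measurable]: "X l \<in> borel_measurable M" if "l \<ge> 1" for l
    using indep that by (auto simp: indep_vars_def)
  have m: "(\<lambda>\<omega>. \<Prod>l=1..k. X l \<omega>) \<in> borel_measurable M" for k
    by (intro borel_measurable_prod_ennreal) auto
  have "(\<integral>\<^sup>+\<omega>. (\<Prod>l=1..k. X l \<omega>) \<partial>M) \<le> ennreal (c ^ k)" for k
  proof -
    have "(\<integral>\<^sup>+\<omega>. (\<Prod>l=1..k. X l \<omega>) \<partial>M) = (\<Prod>l=1..k. \<integral>\<^sup>+\<omega>. X l \<omega> \<partial>M)"
      by (intro indep_vars_nn_integral indep_vars_subset[OF indep]) auto
    also have "\<dots> \<le> (\<Prod>l=1..k. ennreal c)"
      by (intro prod_mono_ennreal le) auto
    finally show ?thesis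
      using c by (simp add: ennreal_power)
  qed
  then have "(\<integral>\<^sup>+\<omega>. (\<Sum>k. \<Prod>l=1..k. X l \<omega>) \<partial>M) \<le> (\<Sum>k. ennreal (c ^ k))"
    by (subst nn_integral_suminf[OF m]) (intro suminf_le, auto)
  also have "\<dots> = ennreal (\<Sum>k. c ^ k)"
    using c by (intro suminf_ennreal2) auto
  also have "\<dots> < \<infinity>"
    by simp
  finally have "AE \<omega> in M. (\<Sum>k. \<Prod>l=1..k. X l \<omega>) \<noteq> \<infinity>"
    using m by (intro nn_integral_PInf_AE) (auto intro: borel_measurable_suminf_order)
  then show ?thesis
  proof eventually_elim
    case (elim \<omega>)
    \<comment> \<open>A finite sum has finite terms, so the products can be read as reals, where the
      terms of a summable series tend to \<open>0\<close>.\<close>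
    define a where "a k = enn2real (\<Prod>l=1..k. X l \<omega>)" for k
    have "(\<Prod>l=1..k. X l \<omega>) < \<infinity>" for k
      using elim ennreal_suminf_lessD[of "\<lambda>k. \<Prod>l=1..k. X l \<omega>" \<infinity> k] by (auto simp: less_top)
    then have a: "(\<Prod>l=1..k. X l \<omega>) = ennreal (a k)" for k
      by (simp add: a_def)
    have "summable a"
      using elim unfolding a by (intro summable_suminf_not_top) (auto simp: a_def)
    then show ?case
      unfolding a by (metis ennreal_0 summable_LIMSEQ_zero tendsto_ennrealI)
  qed
qed

text \<open>The majorant \<open>g\<close> is kept apart from \<open>h\<close> so that only
  \<open>g\<close> has to be integrated in closed form.\<close>

lemma (in prob_space) AE_prod_uniform_tendsto_0:
  fixes \<tau> :: "nat \<Rightarrow> 'a \<Rightarrow> real" and h g :: "real \<Rightarrow> real"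
  assumes indep: "indep_vars (\<lambda>_. borel) \<tau> {1..}"
    and unif: "\<And>l. l \<ge> 1 \<Longrightarrow> distr M borel (\<tau> l) = uniform_measure lborel {0..1}"
    and h[measurable]: "h \<in> borel_measurable borel" and h_nonneg: "\<And>t. 0 \<le> h t"
    and h_le: "\<And>t. t \<in> {0..1} \<Longrightarrow> h t \<le> g t"
    and I: "(g has_integral I) {0..1}" "I < 1"
  shows "AE \<omega> in M. (\<lambda>k. \<Prod>l=1..k. h (\<tau> l \<omega>)) \<longlonglongrightarrow> 0"
proof -
  have g_nonneg: "0 \<le> g t" if "t \<in> {0..1}" for t
    using h_nonneg[of t] h_le[OF that] by linarith
  have [measurable]: "\<tau> l \<in> borel_measurable M" if "l \<ge> 1" for l
    using indep that by (auto simp: indep_vars_def)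
  have "(\<integral>\<^sup>+\<omega>. ennreal (h (\<tau> l \<omega>)) \<partial>M) \<le> ennreal I" if l: "l \<ge> 1" for l
  proof -
    have "(\<integral>\<^sup>+\<omega>. ennreal (h (\<tau> l \<omega>)) \<partial>M) = (\<integral>\<^sup>+t. ennreal (h t) \<partial>distr M borel (\<tau> l))"
      using l by (subst nn_integral_distr) auto
    also have "\<dots> = (\<integral>\<^sup>+t. ennreal (h t) * indicator {0..1} t \<partial>lborel)"
      unfolding unif[OF l] by (subst nn_integral_uniform_measure) (auto simp: divide_ennreal_def)
    also have "\<dots> \<le> (\<integral>\<^sup>+t. ennreal (g t) * indicator {0..1} t \<partial>lborel)"
      using h_le by (intro nn_integral_mono) (auto simp: indicator_def intro: ennreal_leI)
    also have "\<dots> = ennreal I"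
      by (rule nn_integral_has_integral_lebesgue'[OF g_nonneg I(1)])
    finally show ?thesis .
  qed
  moreover have "indep_vars (\<lambda>_. borel) (\<lambda>l \<omega>. ennreal (h (\<tau> l \<omega>))) {1..}"
    by (rule indep_vars_compose2[OF indep]) auto
  moreover have "0 \<le> I"
    using has_integral_nonneg[OF I(1)] g_nonneg by auto
  ultimately have "AE \<omega> in M. (\<lambda>k. \<Prod>l=1..k. ennreal (h (\<tau> l \<omega>))) \<longlonglongrightarrow> 0"
    using I(2) by (intro AE_prod_tendsto_0) auto
  then show ?thesis
  proof eventually_elim
    case (elim \<omega>)
    then have "(\<lambda>k. ennreal (\<Prod>l=1..k. h (\<tau> l \<omega>))) \<longlonglongrightarrow> ennreal 0"
      using h_nonneg by (simp add: prod_ennreal)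
    then show ?case
      by (subst (asm) tendsto_ennreal_iff) (auto intro!: always_eventually prod_nonneg h_nonneg)
  qed
qed

lemma cmod_v: "cmod (v \<tau> \<eta> r z k \<omega>) = cmod \<eta> * (\<Prod>l=1..k. cmod (f r z (\<tau> l \<omega>)))"
  by (simp add: v_def norm_mult prod_norm)

lemma borel_measurable_f [measurable]: "f r z \<in> borel_measurable borel"
  unfolding f_def by measurable

lemma f_0: "f 0 z t = 1 + z + of_real t * z\<^sup>2"
  by (simp add: f_def numeral_2_eq_2)

lemma mem_R_ref_0: "z \<in> R_ref 0 \<longleftrightarrow> cmod (1 + z + z\<^sup>2 / 2) < 1"
  by (simp add: R_ref_def numeral_2_eq_2)

text \<open>This is the mean of the fourth root of the modulus of \<open>f\<close> at
  \<open>z = -2\<close>. A small exponent matters: with exponent \<open>1/2\<close> the mean would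
  already exceed \<open>1\<close>.\<close>

lemma has_integral_root4:
  "((\<lambda>t. \<bar>4 * t - 1\<bar> powr (1/4)) has_integral (1 + 3 powr (5/4)) / 5) {0..1::real}"
proof -
  \<comment> \<open>The interval is split at the zero \<open>1/4\<close> of
    \<open>4 * t - 1\<close>; the interior form of the fundamental theorem asks only for continuity
    there.\<close>
  have "((\<lambda>t. \<bar>4 * t - 1\<bar> powr (1/4)) has_integral
      - ((1 - 4 * (1/4)) powr (5/4) / 5) - - ((1 - 4 * 0) powr (5/4) / 5)) {0..1/4::real}"
  proof (rule fundamental_theorem_of_calculus_interior)
    show "((\<lambda>t. - ((1 - 4 * t) powr (5/4) / 5)) has_vector_derivative \<bar>4 * t - 1\<bar> powr (1/4)) (at t)"
      if "t \<in> {0<..<1/4}" for t :: real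
      using that unfolding has_real_derivative_iff_has_vector_derivative[symmetric]
      by (auto intro!: derivative_eq_intros simp: abs_if)
  qed (simp, intro continuous_on_minus continuous_on_divide continuous_on_powr', auto intro!: continuous_intros)
  moreover have "((\<lambda>t. \<bar>4 * t - 1\<bar> powr (1/4)) has_integral
      (4 * 1 - 1) powr (5/4) / 5 - (4 * (1/4) - 1) powr (5/4) / 5) {1/4..1::real}"
  proof (rule fundamental_theorem_of_calculus_interior)
    show "((\<lambda>t. (4 * t - 1) powr (5/4) / 5) has_vector_derivative \<bar>4 * t - 1\<bar> powr (1/4)) (at t)"
      if "t \<in> {1/4<..<1}" for t :: real
      using that unfolding has_real_derivative_iff_has_vector_derivative[symmetric]
      by (auto intro!: derivative_eq_intros simp: abs_if)
  qed (simp, intro continuous_on_divide continuous_on_powr', auto intro!: continuous_intros)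
  ultimately show ?thesis
    using has_integral_combine[of 0 "1/4::real" 1] by (simp add: add_divide_distrib)
qed

text \<open>Fourth powers compare as \<open>243 < 256\<close>.\<close>

lemma three_powr_less_4: "3 powr (5/4) < (4::real)"
proof -
  have "(3 powr (5/4)) ^ 4 = (3::real) powr 5"
    by (simp add: powr_power)
  also have "\<dots> < 4 ^ 4"
    by simp
  finally show ?thesis
    by (rule power_less_imp_less_base) simp
qed

text \<open>The integrand is the reciprocal of the bound in \<open>cmod_f_0_ge\<close>. Since
  \<open>36/49\<close> is the square of \<open>6/7\<close>, the scaling inside \<open>arctan\<close>
  is rational.\<close>

lemma has_integral_arctan:
  "((\<lambda>t. 16/15 / ((4 * t - 3/2)\<^sup>2 + 36/49)) has_integral
     14/45 * (arctan (35/12) - arctan (-7/4))) {0..1::real}"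
proof -
  have D: "((\<lambda>t. 14/45 * arctan (7/6 * (4 * t - 3/2))) has_vector_derivative
      16/15 / ((4 * t - 3/2)\<^sup>2 + 36/49)) (at t within {0..1})" for t :: real
  proof -
    \<comment> \<open>The case \<open>q = 0\<close> holds because division by zero gives
      \<open>0\<close>, so \<open>q\<close> need not be shown positive.\<close>
    have scale: "14/45 * (inverse (49/36 * q) * (14/3)) = 16/15 / q" for q :: real
      by (cases "q = 0") (simp_all add: field_simps)
    have "1 + (7/6 * (4 * t - 3/2))\<^sup>2 = 49/36 * ((4 * t - 3/2)\<^sup>2 + 36/49)"
      by (simp add: power2_eq_square algebra_simps)
    then have "14/45 * (inverse (1 + (7/6 * (4 * t - 3/2))\<^sup>2) * (14/3)) = 16/15 / ((4 * t - 3/2)\<^sup>2 + 36/49)"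
      by (simp only: scale)
    moreover have "((\<lambda>t. 7/6 * (4 * t - 3/2)) has_real_derivative 14/3) (at t within {0..1})"
      by (auto intro!: derivative_eq_intros)
    then have "((\<lambda>t. 14/45 * arctan (7/6 * (4 * t - 3/2))) has_real_derivative
        14/45 * (inverse (1 + (7/6 * (4 * t - 3/2))\<^sup>2) * (14/3))) (at t within {0..1})"
      by (intro DERIV_cmult DERIV_chain2[OF DERIV_arctan])
    ultimately show ?thesis
      by (simp only: has_real_derivative_iff_has_vector_derivative)
  qed
  have "((\<lambda>t. 16/15 / ((4 * t - 3/2)\<^sup>2 + 36/49)) has_integral
      14/45 * arctan (7/6 * (4 * 1 - 3/2)) - 14/45 * arctan (7/6 * (4 * 0 - 3/2))) {0..1::real}"
    by (rule fundamental_theorem_of_calculus[OF _ D]) simp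
  then show ?thesis
    by (simp add: right_diff_distrib)
qed

text \<open>The difference is below \<open>pi\<close>, Machin's formula gives
  \<open>pi \<le> 16/5\<close>, and \<open>14/45 * (16/5) = 224/225\<close>.\<close>

lemma arctan_diff_less: "14/45 * (arctan x - arctan y) < 1"
proof -
  have "arctan (1/5) \<le> 1/5"
    by (rule arctan_le_self) simp
  moreover have "0 < arctan (1/239)"
    by simp
  ultimately have "pi \<le> 16/5"
    using machin by linarith
  then have "arctan x - arctan y < 16/5"
    using arctan_ubound[of x] arctan_lbound[of y] by linarith
  then have "14/45 * (arctan x - arctan y) < 14/45 * (16/5)"
    by (rule mult_strict_left_mono) simp
  then show ?thesis
    by simp
qed

lemma cmod_f_0_ge:
  "15/16 * ((4 * t - 3/2)\<^sup>2 + 36/49) \<le> (cmod (f 0 (Complex (-1) (12/7)) t))\<^sup>2"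
proof -
  have weights: "15/16 * (3 * a + 4 * b) \<le> 144/49 * a + 9025/2401 * b" if "0 \<le> a" "0 \<le> b" for a b :: real
    using that by simp
  have "f 0 (Complex (-1) (12/7)) t = Complex (- (95/49 * t)) (12/7 * (1 - 2 * t))"
    by (simp add: f_0 complex_eq_iff power2_eq_square algebra_simps)
  then have "(cmod (f 0 (Complex (-1) (12/7)) t))\<^sup>2 = (95/49 * t)\<^sup>2 + (12/7 * (1 - 2 * t))\<^sup>2"
    by (simp add: cmod_power2)
  also have "\<dots> = 144/49 * (1 - 2 * t)\<^sup>2 + 9025/2401 * t\<^sup>2"
    by (simp add: power2_eq_square algebra_simps)
  \<comment> \<open>The weights \<open>45/16\<close> and \<open>15/4\<close> lie slightly below
    \<open>144/49\<close> and \<open>9025/2401\<close>, and make the square easy to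
    complete.\<close>
  also have "\<dots> \<ge> 15/16 * (3 * (1 - 2 * t)\<^sup>2 + 4 * t\<^sup>2)"
    by (intro weights) simp_all
  also have "3 * (1 - 2 * t)\<^sup>2 + 4 * t\<^sup>2 = (4 * t - 3/2)\<^sup>2 + 3/4"
    by (simp add: power2_eq_square algebra_simps)
  \<comment> \<open>Here \<open>3/4\<close> is lowered to the rational square
    \<open>36/49\<close>.\<close>
  finally show ?thesis
    by simp
qed

theorem mainTheorem5:
  fixes M :: "'a measure" and \<tau> :: "nat \<Rightarrow> 'a \<Rightarrow> real" and \<eta> :: complex
  assumes "prob_space M"
    and "prob_space.indep_vars M (\<lambda>_. borel) \<tau> {1..}"
    and "\<And>l. l \<ge> 1 \<Longrightarrow> distr M borel (\<tau> l) = uniform_measure lborel {0..1}"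
    and "\<eta> \<noteq> 0"
  shows "\<exists>r::nat. \<not> R_AS M \<tau> \<eta> r \<subseteq> R_ref r \<and> \<not> R_ref r \<subseteq> R_AS M \<tau> \<eta> r"
proof -
  interpret prob_space M by fact
  note tendsto_0 = AE_prod_uniform_tendsto_0[OF assms(2) assms(3)]
  have "-2 \<in> R_AS M \<tau> \<eta> 0"
  proof -
    have f: "cmod (f 0 (-2) t) = (\<bar>4 * t - 1\<bar> powr (1/4)) ^ 4" for t
    proof -
      have "f 0 (-2) t = of_real (4 * t - 1)"
        by (simp add: f_0)
      then have "cmod (f 0 (-2) t) = \<bar>4 * t - 1\<bar>"
        by (metis norm_of_real)
      then show ?thesis
        by (cases "\<bar>4 * t - 1\<bar> = 0") (simp_all add: powr_power)
    qed
    have "AE \<omega> in M. (\<lambda>k. \<Prod>l=1..k. \<bar>4 * \<tau> l \<omega> - 1\<bar> powr (1/4)) \<longlonglongrightarrow> 0"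
      using three_powr_less_4 by (intro tendsto_0[OF _ _ _ _ has_integral_root4]) auto
    then have "AE \<omega> in M. (\<lambda>k. v \<tau> \<eta> 0 (-2) k \<omega>) \<longlonglongrightarrow> 0"
    proof eventually_elim
      case (elim \<omega>)
      \<comment> \<open>The fourth power turns the product of roots back into the modulus of
        \<open>v\<close>.\<close>
      then have "(\<lambda>k. cmod \<eta> * (\<Prod>l=1..k. \<bar>4 * \<tau> l \<omega> - 1\<bar> powr (1/4)) ^ 4) \<longlonglongrightarrow> cmod \<eta> * 0 ^ 4"
        by (intro tendsto_intros)
      then show ?case
        by - (rule tendsto_norm_zero_cancel, simp add: cmod_v f prod_power_distrib)
    qed
    then show ?thesis
      by (simp add: R_AS_def)
  qed
  moreover have "-2 \<notin> R_ref 0"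
    by (simp add: mem_R_ref_0)
  \<comment> \<open>For \<open>z = -1 + iy\<close> the reference polynomial is the real number
    \<open>(1 - y^2)/2\<close>, of modulus below \<open>1\<close> when
    \<open>0 < y < sqrt 3\<close>; \<open>12/7\<close> is just below \<open>sqrt 3\<close>.\<close>
  moreover define z where "z = Complex (-1) (12/7)"
  have "z \<notin> R_AS M \<tau> \<eta> 0"
  proof
    assume "z \<in> R_AS M \<tau> \<eta> 0"
    then have "AE \<omega> in M. (\<lambda>k. v \<tau> \<eta> 0 z k \<omega>) \<longlonglongrightarrow> 0"
      by (simp add: R_AS_def)
    moreover have pos: "0 < 15/16 * ((4 * t - 3/2)\<^sup>2 + 36/49)" for t :: real
      by (auto intro: add_nonneg_pos)
    have "AE \<omega> in M. (\<lambda>k. \<Prod>l=1..k. inverse ((cmod (f 0 z (\<tau> l \<omega>)))\<^sup>2)) \<longlonglongrightarrow> 0"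
    proof (rule tendsto_0[OF _ _ _ _ has_integral_arctan])
      show "inverse ((cmod (f 0 z t))\<^sup>2) \<le> 16/15 / ((4 * t - 3/2)\<^sup>2 + 36/49)" for t
        using le_imp_inverse_le[OF cmod_f_0_ge pos, of t] by (simp add: z_def field_simps)
      show "14/45 * (arctan (35/12) - arctan (-7/4)) < 1"
        by (rule arctan_diff_less)
    qed auto
    ultimately have "AE \<omega> in M. False"
    proof eventually_elim
      case (elim \<omega>)
      let ?P = "\<lambda>k. \<Prod>l=1..k. cmod (f 0 z (\<tau> l \<omega>))"
      \<comment> \<open>No factor vanishes, so the inverses are genuine and cancel below.\<close>
      have "f 0 z t \<noteq> 0" for t
        using less_le_trans[OF pos cmod_f_0_ge, of t] by (auto simp: z_def)
      then have nz: "?P k \<noteq> 0" for k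
        by simp
      \<comment> \<open>If \<open>v\<close> tended to \<open>0\<close>, so would this product of two
        null sequences, yet it is constantly the squared modulus of \<open>\<eta>\<close>.\<close>
      have "(\<lambda>k. (cmod (v \<tau> \<eta> 0 z k \<omega>))\<^sup>2 * (\<Prod>l=1..k. inverse ((cmod (f 0 z (\<tau> l \<omega>)))\<^sup>2))) \<longlonglongrightarrow> (cmod 0)\<^sup>2 * 0"
        using elim by (intro tendsto_intros)
      moreover have "(cmod (v \<tau> \<eta> 0 z k \<omega>))\<^sup>2 * (\<Prod>l=1..k. inverse ((cmod (f 0 z (\<tau> l \<omega>)))\<^sup>2)) = (cmod \<eta>)\<^sup>2" for k
      proof -
        have "(\<Prod>l=1..k. inverse ((cmod (f 0 z (\<tau> l \<omega>)))\<^sup>2)) = inverse ((?P k)\<^sup>2)"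
          unfolding prod_power_distrib by (rule prod_inversef[unfolded comp_def])
        then show ?thesis
          using nz[of k] by (simp only: cmod_v power_mult_distrib) simp
      qed
      ultimately show False
        using \<open>\<eta> \<noteq> 0\<close> by (simp add: LIMSEQ_const_iff)
    qed
    \<comment> \<open>A space of total mass \<open>1\<close> is not a null set.\<close>
    then show False
      by simp
  qed
  moreover have "z \<in> R_ref 0"
  proof -
    have "1 + z + z\<^sup>2 / 2 = of_real (-95/98)"
      by (simp add: z_def complex_eq_iff power2_eq_square)
    then show ?thesis
      by (simp only: mem_R_ref_0 norm_of_real)
  qed
  ultimately show ?thesis
    by blast
qed

end
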